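(* Let $2\le n<m$ be integers, let $T$ be an admissible system for $(n,m)$, let $I\subseteq\mathbb{R}$ be an interval, let $f:I\to\mathbb{R}$ be continuous and strictly monotone, and let $K:I^n\to I$, $K(x_1,\dots,x_n)=f^{-1}\Big(\frac{f(x_1)+\dots+f(x_n)}{n}\Big)$ be the $n$-variable quasi-arithmetic mean generated by $f$. Then $K^{(T)}$ is the associated $m$-variable quasi-arithmetic mean, i.e. for all $a^{(1)}\le\dots\le a^{(m)}$ in $I$, $$K^{(T)}(a^{(1)},\dots,a^{(m)})=f^{-1}\Big(\frac{f(a^{(1)})+\dots+f(a^{(m)})}{m}\Big).$$
   Context: Let $I_m=\{1,\dots,m\}$ and $I_m^n=\{(j_1,\dots,j_n): j_1,\dots,j_n\in I_m\}$. For $t=(j_1,\dots,j_n)\in I_m^n$, "$j\in t$", $\min t$, $\max t$ refer to the set of coordinates $\{j_1,\dots,j_n\}$. The partial order on $I_m^n$ is coordinatewise. A system $T=\{t_1,\dots,t_m\}$ with $t_i=(j_{i,1},\dots,j_{i,n})\in I_m^n$ is called admissible for $(n,m)$ if: (1) $t_1\le t_2\le\dots\le t_m$; (2) for every $k\in I_m$, $|\{i: k\in t_i\}|=n$; (3) $\min t_i\le i\le\max t_i$ for every $i$, and $\min t_i<i<\max t_i$ if $2\le i\le m-1$; (4) for every $i\ge 2$ there is $j<i$ with $i\in t_j$. For an $n$-variable mean $K$ on $I$ that is symmetric, strictly internal, monotone and continuous (as quasi-arithmetic means are) and $a^{(1)}\le\dots\le a^{(m)}$ in $I$, define sequences by $a^{(i)}_0=a^{(i)}$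 and $a^{(i)}_{k+1}=K(a^{(j_{i,1})}_k,\dots,a^{(j_{i,n})}_k)$ for $1\le i\le m$, $k\ge 0$. For admissible $T$ all $m$ sequences $(a^{(i)}_k)_k$ converge to the same limit, which is denoted $K^{(T)}(a^{(1)},\dots,a^{(m)})$. *)

theory Defs
  imports "HOL-Analysis.Analysis"
begin

text \<open>
  Tuples are lists and indices start at 1. A system \<open>t\<^sub>1, \<dots>, t\<^sub>m\<close> is a function
  \<open>t :: nat \<Rightarrow> nat list\<close> of which only the values on \<open>{1..m}\<close> matter, and likewise for a family
  \<open>a\<^bsup>(1)\<^esup>, \<dots>, a\<^bsup>(m)\<^esup>\<close> of reals; a mean takes the list of its arguments.
\<close>

definition index_tuples :: "nat \<Rightarrow> nat \<Rightarrow> nat list set" where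
  "index_tuples n m = {js. length js = n \<and> set js \<subseteq> {1..m}}"

definition admissible :: "nat \<Rightarrow> nat \<Rightarrow> (nat \<Rightarrow> nat list) \<Rightarrow> bool" where
  "admissible n m t \<longleftrightarrow>
     (\<forall>i\<in>{1..m}. t i \<in> index_tuples n m) \<and>
     (\<forall>i\<in>{1..<m}. list_all2 (\<le>) (t i) (t (Suc i))) \<and>
     (\<forall>k\<in>{1..m}. card {i\<in>{1..m}. k \<in> set (t i)} = n) \<and>
     (\<forall>i\<in>{1..m}. Min (set (t i)) \<le> i \<and> i \<le> Max (set (t i))) \<and>
     (\<forall>i. 2 \<le> i \<and> i \<le> m - 1 \<longrightarrow> Min (set (t i)) < i \<and> i < Max (set (t i))) \<and>
     (\<forall>i\<in>{2..m}. \<exists>j\<in>{1..<i}. i \<in> set (t j))"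

text \<open>\<open>mean_seq K t a i k\<close> is \<open>a\<^bsup>(i)\<^esup>\<^sub>k\<close>.\<close>

fun mean_seq ::
    "(real list \<Rightarrow> real) \<Rightarrow> (nat \<Rightarrow> nat list) \<Rightarrow> (nat \<Rightarrow> real) \<Rightarrow> nat \<Rightarrow> nat \<Rightarrow> real" where
  "mean_seq K t a i 0 = a i"
| "mean_seq K t a i (Suc k) = K (map (\<lambda>j. mean_seq K t a j k) (t i))"

text \<open>
  The extended mean \<open>K\<^bsup>(T)\<^esup>\<close>, unspecified when the \<open>m\<close> sequences have no common limit.
\<close>

definition extended_mean ::
    "(real list \<Rightarrow> real) \<Rightarrow> nat \<Rightarrow> (nat \<Rightarrow> nat list) \<Rightarrow> (nat \<Rightarrow> real) \<Rightarrow> real" where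
  "extended_mean K m t a = (THE L. \<forall>i\<in>{1..m}. (\<lambda>k. mean_seq K t a i k) \<longlonglongrightarrow> L)"

text \<open>The number of variables is the length of the argument list.\<close>

definition quasi_arith_mean :: "real set \<Rightarrow> (real \<Rightarrow> real) \<Rightarrow> real list \<Rightarrow> real" where
  "quasi_arith_mean I f xs = inv_into I f ((\<Sum>x\<leftarrow>xs. f x) / real (length xs))"

end

theory Submission
  imports Defs
begin

text \<open>
  Writing \<open>y\<^sub>k(i) = f (a\<^bsup>(i)\<^esup>\<^sub>k)\<close> turns the recursion into the linear one in which \<open>y\<^sub>k\<^sub>+\<^sub>1(i)\<close>
  is the average of the \<open>y\<^sub>k(j)\<close> over the entries \<open>j\<close> of \<open>t\<^sub>i\<close>. Counting the pairs \<open>(i, k)\<close> with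
  \<open>k \<in> t\<^sub>i\<close> in two ways shows that the entries of each \<open>t\<^sub>i\<close> are distinct, so the matrix of this
  recursion is doubly stochastic and the mean of \<open>y\<^sub>k(1), \<dots>, y\<^sub>k(m)\<close> does not depend on \<open>k\<close>
  (\<open>averaging_orbit_mean\<close>).

  The sequences \<open>y\<^sub>k(i)\<close> converge to a common limit because the index 1 influences everything:
  1 is an entry of \<open>t\<^sub>1\<close>, and every \<open>t\<^sub>i\<close> with \<open>i \<ge> 2\<close> has an entry below \<open>i\<close>, so from any \<open>i\<close> one
  descends to 1 within \<open>m - 1\<close> steps and can wait there. Hence after \<open>m - 1\<close> steps every value
  contains \<open>y\<^sub>k(1)\<close> with weight at least \<open>n\<^bsup>-(m-1)\<^esup>\<close>, and the length of an interval that contains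
  all the values shrinks by the factor \<open>1 - n\<^bsup>-(m-1)\<^esup>\<close> (\<open>averaging_orbit_contraction\<close>). All these
  intervals contain the invariant mean, so it is the limit. Since \<open>f\<close> is a homeomorphism from
  \<open>I\<close> onto \<open>f(I)\<close>, applying the inverse of \<open>f\<close> gives the claim.
\<close>

section \<open>Repeated averaging over a regular system of sets\<close>

locale averaging_system =
  fixes n m :: nat and S :: "nat \<Rightarrow> nat set"
  assumes n_pos: "0 < n" and m_pos: "0 < m"
    and sets: "i \<in> {1..m} \<Longrightarrow> S i \<subseteq> {1..m}"
    and card_sets: "i \<in> {1..m} \<Longrightarrow> card (S i) = n"
    and regular: "k \<in> {1..m} \<Longrightarrow> card {i \<in> {1..m}. k \<in> S i} = n"
    and loop: "1 \<in> S 1"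
    and descend: "i \<in> {2..m} \<Longrightarrow> \<exists>j\<in>S i. j < i"
begin

definition averaging_orbit :: "(nat \<Rightarrow> nat \<Rightarrow> real) \<Rightarrow> bool" where
  "averaging_orbit y \<longleftrightarrow> (\<forall>k. \<forall>i\<in>{1..m}. y (Suc k) i = (\<Sum>j\<in>S i. y k j) / n)"

lemma averaging_orbitD:
  "averaging_orbit y \<Longrightarrow> i \<in> {1..m} \<Longrightarrow> y (Suc k) i = (\<Sum>j\<in>S i. y k j) / n"
  by (auto simp: averaging_orbit_def)

lemma averaging_orbit_uminus:
  "averaging_orbit y \<Longrightarrow> averaging_orbit (\<lambda>k i. - y k i)"
  by (simp add: averaging_orbit_def sum_negf)

lemma averaging_orbit_mean:
  assumes "averaging_orbit y"
  shows "(\<Sum>i=1..m. y k i) / m = (\<Sum>i=1..m. y 0 i) / m"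
proof (induction k)
  case (Suc k)
  have "(\<Sum>i=1..m. y (Suc k) i) = (\<Sum>i=1..m. \<Sum>j\<in>S i. y k j) / n"
    using assms by (simp add: averaging_orbitD sum_divide_distrib)
  also have "(\<Sum>i=1..m. \<Sum>j\<in>S i. y k j) = (\<Sum>i=1..m. \<Sum>j | j \<in> {1..m} \<and> j \<in> S i. y k j)"
  proof (intro sum.cong refl)
    fix i assume "i \<in> {1..m}"
    then show "S i = {j. j \<in> {1..m} \<and> j \<in> S i}"
      using sets by blast
  qed
  also have "\<dots> = (\<Sum>j=1..m. \<Sum>i | i \<in> {1..m} \<and> j \<in> S i. y k j)"
    by (rule sum.swap_restrict) auto
  also have "\<dots> = (\<Sum>j=1..m. n * y k j)"
    by (intro sum.cong refl) (use regular in auto)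
  also have "\<dots> / n = (\<Sum>j=1..m. y k j)"
    using n_pos by (simp flip: sum_distrib_left)
  finally show ?case
    using Suc.IH by simp
qed simp

lemma averaging_orbit_upper_bound:
  assumes y: "averaging_orbit y" and B: "\<And>i. i \<in> {1..m} \<Longrightarrow> y k i \<le> B"
    and i: "i \<in> {1..m}"
  shows "y (k + l) i \<le> B"
  using i
proof (induction l arbitrary: i)
  case (Suc l)
  have "(\<Sum>j\<in>S i. y (k + l) j) \<le> of_nat (card (S i)) * B"
    by (intro sum_bounded_above Suc.IH) (use sets Suc.prems in blast)
  then show ?case
    using averaging_orbitD[OF y Suc.prems, of "k + l"] card_sets[OF Suc.prems] n_pos
    by (simp add: divide_le_eq mult.commute)
qed (use B in simp)

text \<open>
  Each step down along \<open>descend\<close>, or each step spent waiting at 1, passes on at least the fraction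
  \<open>1 / n\<close> of the gap between \<open>B\<close> and the value at 1. So the gap has reached every index up to
  \<open>l + 1\<close> after \<open>l\<close> steps.
\<close>

lemma averaging_orbit_gap:
  assumes y: "averaging_orbit y" and B: "\<And>i. i \<in> {1..m} \<Longrightarrow> y k i \<le> B"
    and i: "i \<in> {1..m}" "i \<le> Suc l"
  shows "y (k + l) i \<le> B - (1 / n) ^ l * (B - y k 1)"
  using i
proof (induction l arbitrary: i)
  case 0
  then have "i = 1" by auto
  then show ?case by simp
next
  case (Suc l)
  let ?g = "(1 / n) ^ l * (B - y k 1)"
  have fin: "finite (S i)"
    using sets[OF Suc.prems(1)] finite_subset by blast
  obtain j where j: "j \<in> S i" "j \<le> Suc l"
  proof (cases "i = 1")
    case True
    then show ?thesis using that[of 1] loop by simp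
  next
    case False
    then show ?thesis using that descend[of i] Suc.prems by fastforce
  qed
  have "j \<in> {1..m}"
    using j sets[OF Suc.prems(1)] by blast
  then have "y (k + l) j \<le> B - ?g"
    using Suc.IH j by blast
  moreover have "(\<Sum>j'\<in>S i - {j}. y (k + l) j') \<le> of_nat (card (S i - {j})) * B"
    by (intro sum_bounded_above averaging_orbit_upper_bound[OF y B])
      (use sets Suc.prems in blast)+
  moreover have "real (card (S i - {j})) = real n - 1"
    using j fin card_sets[OF Suc.prems(1)] n_pos by (simp add: of_nat_diff)
  ultimately have "(\<Sum>j\<in>S i. y (k + l) j) \<le> n * B - ?g"
    using sum.remove[OF fin j(1), of "y (k + l)"] by (simp add: algebra_simps)
  then have "(\<Sum>j\<in>S i. y (k + l) j) / n \<le> (n * B - ?g) / n"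
    by (simp add: divide_right_mono)
  also have "\<dots> = B - (1 / n) ^ Suc l * (B - y k 1)"
    using n_pos by (simp add: field_simps)
  finally show ?case
    using averaging_orbitD[OF y Suc.prems(1)] by simp
qed

definition contraction_factor :: real where
  "contraction_factor = 1 - (1 / n) ^ (m - 1)"

lemma contraction_factor_bounds: "0 \<le> contraction_factor" "contraction_factor < 1"
  using n_pos by (simp_all add: contraction_factor_def power_le_one)

text \<open>
  The upper and the lower bound move towards the same value \<open>y\<^sub>k(1)\<close>, so their gains add up to
  a fixed fraction of \<open>d - c\<close>, wherever \<open>y\<^sub>k(1)\<close> lies between them.
\<close>

lemma averaging_orbit_contraction:
  assumes y: "averaging_orbit y" and cd: "\<And>i. i \<in> {1..m} \<Longrightarrow> y k i \<in> {c..d}"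
  obtains c' d' where "\<And>i. i \<in> {1..m} \<Longrightarrow> y (k + (m - 1)) i \<in> {c'..d'}"
    "d' - c' = contraction_factor * (d - c)"
proof
  let ?w = "(1 / real n) ^ (m - 1)"
  let ?c = "c + ?w * (y k 1 - c)" and ?d = "d - ?w * (d - y k 1)"
  show "y (k + (m - 1)) i \<in> {?c..?d}" if "i \<in> {1..m}" for i
    using averaging_orbit_gap[OF y, of k d i "m - 1"]
      averaging_orbit_gap[OF averaging_orbit_uminus[OF y], of k "- c" i "m - 1"] cd that
    by (auto simp: algebra_simps)
  show "?d - ?c = contraction_factor * (d - c)"
    by (simp add: contraction_factor_def algebra_simps)
qed

lemma averaging_orbit_enclosure:
  assumes y: "averaging_orbit y"
  obtains w where "\<And>q. \<exists>c d. d - c = contraction_factor ^ q * w \<and>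
    (\<forall>i\<in>{1..m}. y (q * (m - 1)) i \<in> {c..d})"
proof
  let ?Y = "y 0 ` {1..m}"
  show "\<exists>c d. d - c = contraction_factor ^ q * (Max ?Y - Min ?Y) \<and>
    (\<forall>i\<in>{1..m}. y (q * (m - 1)) i \<in> {c..d})" for q
  proof (induction q)
    case 0
    show ?case
      by (intro exI[of _ "Min ?Y"] exI[of _ "Max ?Y"]) auto
  next
    case (Suc q)
    then obtain c d where cd: "d - c = contraction_factor ^ q * (Max ?Y - Min ?Y)"
      "\<And>i. i \<in> {1..m} \<Longrightarrow> y (q * (m - 1)) i \<in> {c..d}"
      by blast
    from averaging_orbit_contraction[OF y cd(2)] obtain c' d'
      where "\<And>i. i \<in> {1..m} \<Longrightarrow> y (q * (m - 1) + (m - 1)) i \<in> {c'..d'}"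
        "d' - c' = contraction_factor * (d - c)"
      by blast
    then show ?case
      using cd(1) by (intro exI[of _ c'] exI[of _ d']) (simp add: add.commute)
  qed
qed

theorem averaging_orbit_tendsto:
  assumes y: "averaging_orbit y" and i: "i \<in> {1..m}"
  shows "(\<lambda>k. y k i) \<longlonglongrightarrow> (\<Sum>i=1..m. y 0 i) / m" (is "_ \<longlonglongrightarrow> ?s")
proof (rule LIMSEQ_I)
  fix e :: real
  assume "e > 0"
  obtain w where w: "\<And>q. \<exists>c d. d - c = contraction_factor ^ q * w \<and>
      (\<forall>i\<in>{1..m}. y (q * (m - 1)) i \<in> {c..d})"
    using averaging_orbit_enclosure[OF y] by blast
  have "(\<lambda>q. contraction_factor ^ q * w) \<longlonglongrightarrow> 0"
    using contraction_factor_bounds by (intro tendsto_mult_left_zero LIMSEQ_realpow_zero)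
  then obtain q where "contraction_factor ^ q * w < e"
    using order_tendstoD(2)[OF _ \<open>e > 0\<close>] eventually_sequentially by (metis order_refl)
  then obtain c d where cd: "d - c < e" "\<forall>i\<in>{1..m}. y (q * (m - 1)) i \<in> {c..d}"
    using w[of q] by force
  have "norm (y k i - ?s) < e" if k: "q * (m - 1) \<le> k" for k
  proof -
    obtain l where l: "k = q * (m - 1) + l"
      using le_Suc_ex[OF k] by blast
    have *: "c \<le> y k j \<and> y k j \<le> d" if "j \<in> {1..m}" for j
      using averaging_orbit_upper_bound[OF y, of "q * (m - 1)" d j l]
        averaging_orbit_upper_bound[OF averaging_orbit_uminus[OF y], of "q * (m - 1)" "- c" j l]
        cd(2) that l by auto
    have "m * c \<le> (\<Sum>j=1..m. y k j)" "(\<Sum>j=1..m. y k j) \<le> m * d"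
      using sum_bounded_below[of "{1..m}" c "y k"] sum_bounded_above[of "{1..m}" "y k" d] *
      by auto
    then have "c \<le> (\<Sum>j=1..m. y k j) / m" "(\<Sum>j=1..m. y k j) / m \<le> d"
      using m_pos by (simp_all add: field_simps)
    then have "c \<le> ?s" "?s \<le> d"
      unfolding averaging_orbit_mean[OF y, of k] .
    then show ?thesis
      using *[OF i] cd(1) by (simp add: abs_less_iff)
  qed
  then show "\<exists>k0. \<forall>k\<ge>k0. norm (y k i - ?s) < e"
    by blast
qed

end

section \<open>The sets underlying an admissible system\<close>

text \<open>
  The incidence condition counts indices \<open>i\<close>, not occurrences. It still excludes repeated
  entries: the \<open>m\<close> sets \<open>set (t i)\<close> have at most \<open>n\<close> elements each and \<open>m n\<close> elements together.
\<close>

lemma admissible_distinct: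
  assumes "admissible n m t" "i \<in> {1..m}"
  shows "distinct (t i)"
proof -
  have sub: "set (t i) \<subseteq> {1..m}" "length (t i) = n" if "i \<in> {1..m}" for i
    using assms(1) that by (auto simp: admissible_def index_tuples_def)
  have "(\<Sum>i=1..m. card (set (t i))) = (\<Sum>i=1..m. \<Sum>k | k \<in> {1..m} \<and> k \<in> set (t i). 1)"
  proof (intro sum.cong refl)
    fix i assume "i \<in> {1..m}"
    then have "{k. k \<in> {1..m} \<and> k \<in> set (t i)} = set (t i)"
      using sub by blast
    then show "card (set (t i)) = (\<Sum>k | k \<in> {1..m} \<and> k \<in> set (t i). 1)"
      by simp
  qed
  also have "\<dots> = (\<Sum>k=1..m. \<Sum>i | i \<in> {1..m} \<and> k \<in> set (t i). 1)"
    by (rule sum.swap_restrict) auto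
  also have "\<dots> = (\<Sum>k=1..m. n)"
    by (intro sum.cong refl) (use assms(1) in \<open>auto simp: admissible_def\<close>)
  finally have eq: "(\<Sum>i=1..m. card (set (t i))) = (\<Sum>i=1..m. n)" .
  have le: "card (set (t i)) \<le> n" if "i \<in> {1..m}" for i
    using card_length[of "t i"] sub(2)[OF that] by simp
  have "card (set (t i)) = n"
    using sum_mono_inv[OF eq le assms(2)] by simp
  then show ?thesis
    using sub(2)[OF assms(2)] by (simp add: card_distinct)
qed

lemma admissible_averaging_system:
  assumes n: "2 \<le> n" and m: "n < m" and adm: "admissible n m t"
  shows "averaging_system n m (\<lambda>i. set (t i))"
proof
  show "0 < n" "0 < m"
    using n m by auto
  show sub: "set (t i) \<subseteq> {1..m}" if "i \<in> {1..m}" for i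
    using adm that by (auto simp: admissible_def index_tuples_def)
  show card: "card (set (t i)) = n" if "i \<in> {1..m}" for i
    using distinct_card[OF admissible_distinct[OF adm that]] adm that
    by (simp add: admissible_def index_tuples_def)
  have ne: "set (t i) \<noteq> {}" if "i \<in> {1..m}" for i
    using card[OF that] n by auto
  show "card {i \<in> {1..m}. k \<in> set (t i)} = n" if "k \<in> {1..m}" for k
    using adm that by (simp add: admissible_def)
  have one: "1 \<in> {1..m}"
    using m by simp
  have "Min (set (t 1)) \<in> set (t 1)"
    using ne[OF one] by simp
  moreover have "Min (set (t 1)) \<le> 1"
    using adm one by (auto simp: admissible_def)
  ultimately show "1 \<in> set (t 1)"
    using sub[OF one] by (metis atLeastAtMost_iff le_antisym subsetD)
  show "\<exists>j\<in>set (t i). j < i" if i: "i \<in> {2..m}" for i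
  proof (cases "i = m")
    case True
    \<comment> \<open>At \<open>i = m\<close> the smaller entry comes from \<open>n \<ge> 2\<close>: distinct entries cannot all be \<open>m\<close>.\<close>
    have "\<not> set (t m) \<subseteq> {m}"
      using card[of m] n m card_mono[of "{m}" "set (t m)"] by auto
    then show ?thesis
      using sub[of m] True i by fastforce
  next
    case False
    then have "Min (set (t i)) < i"
      using adm i by (auto simp: admissible_def)
    then show ?thesis
      using ne[of i] i by (intro bexI[of _ "Min (set (t i))"]) auto
  qed
qed

section \<open>Quasi-arithmetic means\<close>

lemma mean_mem_convex:
  fixes X :: "real set"
  assumes "convex X" "finite A" "A \<noteq> {}" "\<And>i. i \<in> A \<Longrightarrow> g i \<in> X"
  shows "(\<Sum>i\<in>A. g i) / card A \<in> X"
  using convex_sum[of A X "\<lambda>_. 1 / card A" g] assms by (simp add: sum_divide_distrib)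

lemma convex_image_interval:
  fixes f :: "real \<Rightarrow> real"
  assumes "is_interval I" "continuous_on I f"
  shows "convex (f ` I)"
  using connected_continuous_image[OF assms(2)] assms(1)
  by (simp add: is_interval_connected_1 is_interval_convex_1[symmetric])

lemma continuous_on_inv_into_interval:
  fixes f :: "real \<Rightarrow> real"
  assumes I: "is_interval I" and f: "continuous_on I f" "inj_on f I"
  shows "continuous_on (f ` I) (inv_into I f)"
proof -
  obtain g where g: "homeomorphism I (f ` I) f g"
    using injective_into_1d_eq_homeomorphism[OF f(1)] f(2) I
      is_interval_path_connected by blast
  have "inv_into I f y = g y" if "y \<in> f ` I" for y
    using that g f(2) by (auto simp: homeomorphism_def)
  then show ?thesis
    using g by (simp add: homeomorphism_def cong: continuous_on_cong)
qed

lemma strict_imp_inj_on: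
  fixes f :: "real \<Rightarrow> real"
  assumes "strict_mono_on I f \<or> strict_antimono_on I f"
  shows "inj_on f I"
proof (rule linorder_inj_onI')
  fix x y assume "x \<in> I" "y \<in> I" "x < y"
  then show "f x \<noteq> f y"
    using assms by (auto dest: monotone_onD)
qed

lemma quasi_arith_mean_distinct:
  assumes I: "is_interval I" "continuous_on I f"
    and js: "distinct js" "js \<noteq> []" "\<And>j. j \<in> set js \<Longrightarrow> x j \<in> I"
  shows "quasi_arith_mean I f (map x js) \<in> I"
    and "f (quasi_arith_mean I f (map x js)) = (\<Sum>j\<in>set js. f (x j)) / length js"
proof -
  have eq: "quasi_arith_mean I f (map x js) = inv_into I f ((\<Sum>j\<in>set js. f (x j)) / length js)"
    using js(1) by (simp add: quasi_arith_mean_def sum_list_distinct_conv_sum_set o_def)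
  have "(\<Sum>j\<in>set js. f (x j)) / length js \<in> f ` I"
    using mean_mem_convex[OF convex_image_interval[OF I], of "set js" "\<lambda>j. f (x j)"] js
    by (simp add: distinct_card)
  then show "quasi_arith_mean I f (map x js) \<in> I"
    and "f (quasi_arith_mean I f (map x js)) = (\<Sum>j\<in>set js. f (x j)) / length js"
    unfolding eq by (auto intro: inv_into_into f_inv_into_f)
qed

lemma extended_mean_eq:
  assumes "0 < m" "\<And>i. i \<in> {1..m} \<Longrightarrow> (\<lambda>k. mean_seq K t a i k) \<longlonglongrightarrow> L"
  shows "extended_mean K m t a = L"
  unfolding extended_mean_def
proof (rule the_equality)
  fix L' assume "\<forall>i\<in>{1..m}. (\<lambda>k. mean_seq K t a i k) \<longlonglongrightarrow> L'"
  moreover have "1 \<in> {1..m}"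
    using assms(1) by simp
  ultimately show "L' = L"
    using assms(2) LIMSEQ_unique by blast
qed (use assms(2) in blast)

theorem theorem2p11:
  fixes n m :: nat and t :: "nat \<Rightarrow> nat list"
    and I :: "real set" and f :: "real \<Rightarrow> real"
  assumes "2 \<le> n" and "n < m"
    and "admissible n m t"
    and "is_interval I"
    and "continuous_on I f"
    and "strict_mono_on I f \<or> strict_antimono_on I f"
  shows "\<forall>a :: nat \<Rightarrow> real. (\<forall>i\<in>{1..m}. a i \<in> I) \<and> mono_on {1..m} a \<longrightarrow>
      (\<forall>i\<in>{1..m}. (\<lambda>k. mean_seq (quasi_arith_mean I f) t a i k)
         \<longlonglongrightarrow> extended_mean (quasi_arith_mean I f) m t a) \<and>
      extended_mean (quasi_arith_mean I f) m t a
        = inv_into I f ((\<Sum>i=1..m. f (a i)) / real m)"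
proof (intro allI impI, elim conjE)
  fix a :: "nat \<Rightarrow> real"
  assume a: "\<forall>i\<in>{1..m}. a i \<in> I"
  interpret averaging_system n m "\<lambda>i. set (t i)"
    by (rule admissible_averaging_system) fact+
  let ?x = "\<lambda>k i. mean_seq (quasi_arith_mean I f) t a i k"
  let ?s = "(\<Sum>i=1..m. f (a i)) / real m"
  have inj: "inj_on f I"
    using assms(6) by (rule strict_imp_inj_on)
  have t: "distinct (t i)" "length (t i) = n" "t i \<noteq> []" if "i \<in> {1..m}" for i
    using admissible_distinct[OF assms(3) that] card_sets[OF that] n_pos
    by (auto simp: distinct_card)
  have x_mem: "?x k i \<in> I" if "i \<in> {1..m}" for k i
    using that
  proof (induction k arbitrary: i)
    case (Suc k)
    have "?x k j \<in> I" if "j \<in> set (t i)" for j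
      using Suc.IH sets[OF Suc.prems] that by blast
    then show ?case
      using quasi_arith_mean_distinct(1)[OF assms(4,5) t(1,3)[OF Suc.prems]] by simp
  qed (use a in simp)
  have "averaging_orbit (\<lambda>k i. f (?x k i))"
    unfolding averaging_orbit_def
  proof (intro allI ballI)
    fix k i assume i: "i \<in> {1..m}"
    have "?x k j \<in> I" if "j \<in> set (t i)" for j
      using x_mem sets[OF i] that by blast
    then show "f (?x (Suc k) i) = (\<Sum>j\<in>set (t i). f (?x k j)) / n"
      using quasi_arith_mean_distinct(2)[OF assms(4,5) t(1,3)[OF i]] t(2)[OF i] by simp
  qed
  then have lim: "(\<lambda>k. f (?x k i)) \<longlonglongrightarrow> ?s" if "i \<in> {1..m}" for i
    using averaging_orbit_tendsto that by fastforce
  have s: "?s \<in> f ` I"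
    using mean_mem_convex[OF convex_image_interval[OF assms(4,5)], of "{1..m}" "\<lambda>i. f (a i)"]
      a m_pos by simp
  have lim': "(\<lambda>k. ?x k i) \<longlonglongrightarrow> inv_into I f ?s" if i: "i \<in> {1..m}" for i
  proof -
    have "(\<lambda>k. inv_into I f (f (?x k i))) \<longlonglongrightarrow> inv_into I f ?s"
      using continuous_on_inv_into_interval[OF assms(4,5) inj] lim[OF i] s
      by (rule continuous_on_tendsto_compose) (use x_mem[OF i] in simp)
    then show ?thesis
      using x_mem[OF i] inj by simp
  qed
  then have "extended_mean (quasi_arith_mean I f) m t a = inv_into I f ?s"
    using m_pos by (intro extended_mean_eq)
  then show "(\<forall>i\<in>{1..m}. (\<lambda>k. ?x k i) \<longlonglongrightarrow> extended_mean (quasi_arith_mean I f) m t a) \<and>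
      extended_mean (quasi_arith_mean I f) m t a = inv_into I f ?s"
    using lim' by simp
qed

end
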